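(* $\omega(2,3)=6$.
   Context: Let $\mathcal A=\{1,2,\ldots,a\}$. A submatrix of a matrix is obtained by selecting some rows and some columns (not necessarily contiguous), keeping their order. An omnimosaic $O(n,k,a)$ is an $n\times n$ matrix with entries in $\mathcal A$ that contains, as a submatrix, each of the $a^{k^2}$ $k\times k$ matrices over $\mathcal A$. For positive integers $k,a$, $\omega(k,a)$ denotes the smallest $n$ for which an $O(n,k,a)$ omnimosaic exists. *)

theory Defs
  imports "Jordan_Normal_Form.DL_Submatrix"
begin

definition mats_over :: "nat \<Rightarrow> nat \<Rightarrow> nat mat set" where
  "mats_over m a = {A \<in> carrier_mat m m. elements_mat A \<subseteq> {1..a}}"

text \<open>Rows and columns of \<open>'a mat\<close> are numbered from 0, and \<open>submatrix\<close> keeps the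
  selected rows and columns in increasing order.\<close>

definition contains_submatrix :: "'a mat \<Rightarrow> 'a mat \<Rightarrow> bool" where
  "contains_submatrix A B \<longleftrightarrow>
     (\<exists>I J. I \<subseteq> {..<dim_row A} \<and> J \<subseteq> {..<dim_col A} \<and> submatrix A I J = B)"

definition omnimosaic :: "nat \<Rightarrow> nat \<Rightarrow> nat \<Rightarrow> nat mat \<Rightarrow> bool" where
  "omnimosaic n k a A \<longleftrightarrow> A \<in> mats_over n a \<and> (\<forall>B \<in> mats_over k a. contains_submatrix A B)"

definition omega :: "nat \<Rightarrow> nat \<Rightarrow> nat" where
  "omega k a = (LEAST n. \<exists>A. omnimosaic n k a A)"

end

theory Submission
  imports Defs
begin

text \<open>
  The upper bound is an explicit \<open>6 \<times> 6\<close> matrix. A smaller omnimosaic would remain one inside a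
  \<open>5 \<times> 5\<close> array, so the lower bound only concerns five rows and five columns, which offer 100
  two-by-two blocks for the 81 required matrices. The slack of 19 is too large for a plain count;
  instead one letter is considered at a time.

  Fix a letter that occupies \<open>n\<close> cells. Prescribing it at two of the four places of a block leaves
  nine matrices, so each of the six choices of two places is realised by at least nine blocks.
  Two cells of the letter in general position lie in exactly one block, at opposite corners; this
  makes at least nine pairs for each of the two diagonals. Two cells in a common row lie in exactly
  four blocks, at the top of some and at the bottom of the others, so four times the number of such
  pairs is at least 18 and there are at least five; the same holds for columns. Hence
  \<open>n choose 2 \<ge> 5 + 5 + 9 + 9 = 28\<close>, that is, \<open>n \<ge> 8\<close> (\<open>balanced_ones\<close>). Three letters share 25
  cells, so two of them occupy exactly eight cells each.

  For \<open>n = 8\<close> the bounds 5, 5, 9 and 9 are attained. The row sums of the cells of such a letter,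
  and by transposition the column sums, are then confined to 16 permutations of \<open>3, 2, 2, 1, 0\<close>
  (\<open>slim_in_slim_sums\<close>). Running through the 0-1 matrices with these margins and discarding those
  that have too few blocks of some 0-1 pattern leaves 16 cell sets (\<open>slim_grid\<close>). Any two of these
  sets intersect (\<open>slim_grids_meet\<close>), but two different letters occupy disjoint sets.

  The enumeration is a rewriting proof, so its functions on lists are written for the simplifier:
  large terms that are already in normal form should not be carried through conditionals.
\<close>

section \<open>The two-by-two blocks of an array\<close>

fun pairs :: "'a list \<Rightarrow> ('a \<times> 'a) list" where
  "pairs [] = []"
| "pairs (x # xs) = map (Pair x) xs @ pairs xs"

lemma pairs_map: "pairs (map f xs) = map (map_prod f f) (pairs xs)"
  by (induction xs) auto

lemma set_pairs_subset: "set (pairs xs) \<subseteq> set xs \<times> set xs"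
  by (induction xs) auto

lemma set_pairs_sorted:
  "sorted_wrt (<) xs \<Longrightarrow> set (pairs xs) = {(x, y). x \<in> set xs \<and> y \<in> set xs \<and> (x::nat) < y}"
  by (induction xs) (auto dest: less_asym)

lemma set_pairs_upt: "set (pairs [0..<n]) = {(i, k). i < k \<and> k < n}"
  by (subst set_pairs_sorted) auto

text \<open>Each entry belongs to \<open>length xs - 1\<close> pairs. This is what relates the pairs of equal letters in
  a row to the blocks above and below that row.\<close>

lemma sum_pairs_both:
  fixes f :: "'a \<Rightarrow> nat"
  shows "(\<Sum>(x, y)\<leftarrow>pairs xs. f x + f y) = (length xs - 1) * sum_list (map f xs)"
proof (induction xs)
  case (Cons x xs)
  have "(\<Sum>y\<leftarrow>xs. f x + f y) = length xs * f x + sum_list (map f xs)"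
    by (induction xs) (auto simp: algebra_simps)
  then show ?case
    using Cons by (cases xs) (auto simp: comp_def algebra_simps)
qed simp

text \<open>A block is stored by columns, as \<open>((a, c), (b, d))\<close> for the matrix with rows \<open>a b\<close> and \<open>c d\<close>:
  two rows \<open>u\<close> and \<open>v\<close> are zipped into a list of columns, of which two are chosen in order.\<close>

definition blocks :: "'a list list \<Rightarrow> (('a \<times> 'a) \<times> ('a \<times> 'a)) list" where
  "blocks M = concat (map (\<lambda>(u, v). pairs (zip u v)) (pairs M))"

lemma blocks_map:
  "blocks (map (map f) M) = map (map_prod (map_prod f f) (map_prod f f)) (blocks M)"
proof -
  have "pairs (zip (map f u) (map f v)) = map (map_prod (map_prod f f) (map_prod f f)) (pairs (zip u v))" for u v
    by (simp add: zip_map_map pairs_map flip: map_prod_def)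
  then show ?thesis
    by (simp add: blocks_def pairs_map map_concat comp_def split_def)
qed

lemma length_filter_blocks:
  "length (filter P (blocks M)) = (\<Sum>(u, v)\<leftarrow>pairs M. length (filter P (pairs (zip u v))))"
  by (simp add: blocks_def filter_concat length_concat comp_def split_def)

definition grid :: "nat \<Rightarrow> (nat \<Rightarrow> nat \<Rightarrow> 'a) \<Rightarrow> 'a list list" where
  "grid n F = map (\<lambda>i. map (F i) [0..<n]) [0..<n]"

lemma map_grid: "map (map f) (grid n F) = grid n (\<lambda>i j. f (F i j))"
  by (simp add: grid_def comp_def)

lemma grid_simps [simp]: "length (grid n F) = n" "r \<in> set (grid n F) \<Longrightarrow> length r = n"
  by (auto simp: grid_def)

lemma set_blocks_grid:
  "set (blocks (grid n F)) = {((F i j, F k j), (F i l, F k l)) | i k j l. i < k \<and> k < n \<and> j < l \<and> l < n}"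
proof -
  have zip: "zip (map (F i) xs) (map (F k) xs) = map (\<lambda>j. (F i j, F k j)) xs" for i k xs
    by (induction xs) auto
  show ?thesis
    unfolding blocks_def grid_def pairs_map
    by (auto simp: zip pairs_map set_pairs_upt image_iff split: prod.splits) blast+
qed

lemma blocks_grid_mono:
  assumes "m \<le> n"
  shows "set (blocks (grid m F)) \<subseteq> set (blocks (grid n F))"
proof
  fix z
  assume "z \<in> set (blocks (grid m F))"
  then obtain i k j l where "i < k" "k < m" "j < l" "l < m"
    and "z = ((F i j, F k j), (F i l, F k l))"
    unfolding set_blocks_grid by blast
  then show "z \<in> set (blocks (grid n F))"
    unfolding set_blocks_grid using assms
    by (intro CollectI exI[of _ i] exI[of _ k] exI[of _ j] exI[of _ l]) auto
qed

section \<open>Pairs of marked cells\<close>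

text \<open>This is \<open>n choose 2\<close>, in a form that evaluates by rewriting.\<close>

fun tri :: "nat \<Rightarrow> nat" where
  "tri 0 = 0"
| "tri (Suc n) = n + tri n"

lemma tri_add: "tri (m + n) = tri m + tri n + m * n"
  by (induction m) auto

lemma tri_mono: "m \<le> n \<Longrightarrow> tri m \<le> tri n"
  by (metis tri_add le_add1 le_iff_add add.assoc)

lemma tri_sum_list:
  "tri (sum_list xs) = sum_list (map tri xs) + (\<Sum>(x, y)\<leftarrow>pairs xs. x * y)"
proof (induction xs)
  case (Cons x xs)
  then show ?case
    by (auto simp: tri_add comp_def sum_list_const_mult)
qed simp

definition ones :: "bool list \<Rightarrow> nat" where
  "ones r = length (filter (\<lambda>b. b) r)"

lemma ones_simps [simp]: "ones [] = 0" "ones (b # r) = of_bool b + ones r"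
  by (auto simp: ones_def)

lemma num_zip_1: "length u = length v \<Longrightarrow> length (filter (\<lambda>(b, d). b) (zip u v)) = ones u"
  by (induction u v rule: list_induct2) auto

lemma num_zip_2: "length u = length v \<Longrightarrow> length (filter (\<lambda>(b, d). d) (zip u v)) = ones v"
  by (induction u v rule: list_induct2) auto

lemma num_top_row:
  "length u = length v \<Longrightarrow>
   length (filter (\<lambda>((a, c), (b, d)). a \<and> b) (pairs (zip u v))) = tri (ones u)"
  by (induction u v rule: list_induct2) (auto simp: filter_map comp_def num_zip_1)

lemma num_bottom_row:
  "length u = length v \<Longrightarrow>
   length (filter (\<lambda>((a, c), (b, d)). c \<and> d) (pairs (zip u v))) = tri (ones v)"
  by (induction u v rule: list_induct2) (auto simp: filter_map comp_def num_zip_2)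

definition common :: "bool list \<Rightarrow> bool list \<Rightarrow> nat" where
  "common u v = length (filter (\<lambda>(a, c). a \<and> c) (zip u v))"

lemma length_filter_sum: "length (filter P xs) = (\<Sum>x\<leftarrow>xs. of_bool (P x))"
  by (induction xs) auto

lemma num_columns:
  assumes "length u = length v"
  shows "length (filter (\<lambda>((a, c), (b, d)). a \<and> c) (pairs (zip u v))) +
   length (filter (\<lambda>((a, c), (b, d)). b \<and> d) (pairs (zip u v))) = (length u - 1) * common u v"
  using sum_pairs_both[of "\<lambda>(a, c). of_bool (a \<and> c)" "zip u v"] assms
  by (simp add: length_filter_sum common_def split_def flip: sum_list_addf)

text \<open>A pair of marked cells from two different rows lies in one column or on one of the two diagonals
  of a block.\<close>

lemma ones_mult_ones:
  "length u = length v \<Longrightarrow>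
   ones u * ones v = common u v +
     length (filter (\<lambda>((a, c), (b, d)). a \<and> d) (pairs (zip u v))) +
     length (filter (\<lambda>((a, c), (b, d)). c \<and> b) (pairs (zip u v)))"
proof (induction u v rule: list_induct2)
  case (Cons x xs y ys)
  then show ?case
    using num_zip_1[OF Cons.hyps] num_zip_2[OF Cons.hyps]
    by (auto simp: filter_map comp_def common_def algebra_simps split_def)
qed (simp add: common_def)

section \<open>Balanced 0-1 arrays\<close>

text \<open>Of three letters, one is marked. The weight of a set of truth values is the number of letters
  whose mark lies in the set.\<close>

definition wt :: "bool set \<Rightarrow> nat" where
  "wt P = (\<Sum>b\<in>P. if b then 1 else 2)"

lemma wt_simps [simp]: "wt {True} = 1" "wt {False} = 2" "wt UNIV = 3"
  by (simp_all add: wt_def UNIV_bool)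

text \<open>Balance is all that is used of the cells of one letter: prescribing, for each of the four places,
  which marks are allowed, the blocks that comply are at least as many as the matrices that comply.
  Sets of marks are prescribed instead of single marks, so that leaving a place free (\<open>UNIV\<close>) is
  an instance.\<close>

definition balanced :: "bool list list \<Rightarrow> bool" where
  "balanced B \<longleftrightarrow> (\<forall>P Q R T. wt P * wt Q * (wt R * wt T) \<le>
     length (filter (\<lambda>((a, c), (b, d)). a \<in> P \<and> c \<in> Q \<and> b \<in> R \<and> d \<in> T) (blocks B)))"

text \<open>The matrices that comply form a product of sets of letters, and each of them is a block.\<close>

lemma balanced_letter:
  assumes "(L \<times> L) \<times> (L \<times> L) \<subseteq> set (blocks M)" and "x \<in> L" and "card L = 3"
  shows "balanced (map (map (\<lambda>y. y = x)) M)"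
  unfolding balanced_def
proof (intro allI)
  fix P Q R T :: "bool set"
  define S where "S P = {y \<in> L. (y = x) \<in> P}" for P
  have [simp]: "finite L"
    using assms(3) card.infinite by fastforce
  have fin [simp]: "finite (S P)" for P
    by (simp add: S_def)
  have card: "card (S P) = wt P" for P
  proof -
    have L: "card (L - {x}) = 2"
      using assms by simp
    have "P \<in> Pow {False, True}"
      unfolding UNIV_bool[symmetric] by simp
    then consider "P = {}" | "P = {True}" | "P = {False}" | "P = UNIV"
      unfolding Pow_insert Pow_empty UNIV_bool by auto
    then show ?thesis
    proof cases
      case 1
      then show ?thesis by (simp add: S_def wt_def)
    next
      case 2
      then have "S P = {x}" using assms(2) by (auto simp: S_def)
      then show ?thesis using 2 by simp
    next
      case 3
      then have "S P = L - {x}" by (auto simp: S_def)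
      then show ?thesis using 3 L by simp
    next
      case 4
      then have "S P = L" by (simp add: S_def)
      then show ?thesis using 4 assms(3) by simp
    qed
  qed
  let ?A = "\<lambda>((a, c), (b, d)). a \<in> S P \<and> c \<in> S Q \<and> b \<in> S R \<and> d \<in> S T"
  have "wt P * wt Q * (wt R * wt T) = card ((S P \<times> S Q) \<times> (S R \<times> S T))"
    by (simp add: card_cartesian_product card)
  also have "\<dots> \<le> card (set (filter ?A (blocks M)))"
    using assms(1) by (intro card_mono) (auto simp: S_def)
  also have "\<dots> \<le> length (filter ?A (blocks M))"
    by (rule card_length)
  also have "\<dots> \<le> length (filter (\<lambda>((a, c), (b, d)). a \<in> P \<and> c \<in> Q \<and> b \<in> R \<and> d \<in> T)
      (blocks (map (map (\<lambda>y. y = x)) M)))"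
    unfolding blocks_map filter_map length_map
    by (subst (1 2) length_filter_sum, rule sum_list_mono) (auto simp: S_def)
  finally show "wt P * wt Q * (wt R * wt T) \<le> length (filter (\<lambda>((a, c), (b, d)). a \<in> P \<and> c \<in> Q \<and> b \<in> R \<and> d \<in> T)
      (blocks (map (map (\<lambda>y. y = x)) M)))" .
qed

lemma balancedD:
  assumes "balanced B"
  shows "wt P * wt Q * (wt R * wt T) \<le>
     length (filter (\<lambda>((a, c), (b, d)). a \<in> P \<and> c \<in> Q \<and> b \<in> R \<and> d \<in> T) (blocks B))"
  using assms by (simp add: balanced_def)

lemma sum_pairs_cong:
  assumes "\<And>u v. u \<in> set M \<Longrightarrow> v \<in> set M \<Longrightarrow> f u v = g u v"
  shows "(\<Sum>(u, v)\<leftarrow>pairs M. f u v) = (\<Sum>(u, v)\<leftarrow>pairs M. g u v)"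
  using assms set_pairs_subset[of M] by (intro arg_cong[of _ _ sum_list] map_cong) auto

lemma tops_bottoms:
  assumes "\<And>r. r \<in> set B \<Longrightarrow> length r = n"
  shows "length (filter (\<lambda>((a, c), (b, d)). a \<and> b) (blocks B)) = (\<Sum>(s, t)\<leftarrow>pairs (map ones B). tri s)"
    and "length (filter (\<lambda>((a, c), (b, d)). c \<and> d) (blocks B)) = (\<Sum>(s, t)\<leftarrow>pairs (map ones B). tri t)"
  unfolding length_filter_blocks pairs_map map_map
  using assms by (auto simp: comp_def split_def num_top_row[unfolded split_def] num_bottom_row[unfolded split_def]
     intro!: arg_cong[of _ _ sum_list] dest!: subsetD[OF set_pairs_subset])

text \<open>The row sums of a balanced array with eight marks. The last two conjuncts count the blocks with
  two marks in the top row and in the bottom row.\<close>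

definition slim :: "nat list \<Rightarrow> bool" where
  "slim s \<longleftrightarrow> sum_list s = 8 \<and> sum_list (map tri s) = 5 \<and>
     9 \<le> (\<Sum>(x, y)\<leftarrow>pairs s. tri x) \<and> 9 \<le> (\<Sum>(x, y)\<leftarrow>pairs s. tri y)"

text \<open>The count of the introduction: the pairs of marked cells split into \<open>R\<close> pairs in a row, \<open>C\<close> pairs in
  a column, and the pairs on either diagonal, with lower bounds 5, 5, 9 and 9. Since these add up to
  \<open>tri 8\<close>, eight marks force \<open>R = 5\<close>.\<close>

lemma balanced_ones:
  assumes len: "\<And>r. r \<in> set B \<Longrightarrow> length r = 5" "length B = 5" and "balanced B"
  defines "n \<equiv> sum_list (map ones B)"
  shows "8 \<le> n" and "n = 8 \<Longrightarrow> slim (map ones B)"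
proof -
  note bal = balancedD[OF \<open>balanced B\<close>]
  define num where "num P = length (filter P (blocks B))" for P
  have tb: "9 \<le> num (\<lambda>((a, c), (b, d)). a \<and> b)" "9 \<le> num (\<lambda>((a, c), (b, d)). c \<and> d)"
    using bal[of "{True}" UNIV "{True}" UNIV] bal[of UNIV "{True}" UNIV "{True}"]
    by (simp_all add: num_def)
  have lr: "9 \<le> num (\<lambda>((a, c), (b, d)). a \<and> c)" "9 \<le> num (\<lambda>((a, c), (b, d)). b \<and> d)"
    using bal[of "{True}" "{True}" UNIV UNIV] bal[of UNIV UNIV "{True}" "{True}"]
    by (simp_all add: num_def)
  have da: "9 \<le> num (\<lambda>((a, c), (b, d)). a \<and> d)" "9 \<le> num (\<lambda>((a, c), (b, d)). c \<and> b)"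
    using bal[of "{True}" UNIV UNIV "{True}"] bal[of UNIV "{True}" "{True}" UNIV]
    by (simp_all add: num_def)
  define R where "R = sum_list (map tri (map ones B))"
  define C where "C = (\<Sum>(u, v)\<leftarrow>pairs B. common u v)"
  have R: "num (\<lambda>((a, c), (b, d)). a \<and> b) + num (\<lambda>((a, c), (b, d)). c \<and> d) = 4 * R"
    using sum_pairs_both[of tri "map ones B"] tops_bottoms[OF len(1), of B]
    by (simp add: num_def R_def len split_def sum_list_addf)
  have C: "num (\<lambda>((a, c), (b, d)). a \<and> c) + num (\<lambda>((a, c), (b, d)). b \<and> d) = 4 * C"
  proof -
    have "(\<Sum>(u, v)\<leftarrow>pairs B. length (filter (\<lambda>((a, c), (b, d)). a \<and> c) (pairs (zip u v))) +
        length (filter (\<lambda>((a, c), (b, d)). b \<and> d) (pairs (zip u v)))) = (\<Sum>(u, v)\<leftarrow>pairs B. 4 * common u v)"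
    proof (rule sum_pairs_cong)
      fix u v assume "u \<in> set B" "v \<in> set B"
      then have "length u = 5" "length v = 5"
        by (simp_all add: len)
      then show "length (filter (\<lambda>((a, c), (b, d)). a \<and> c) (pairs (zip u v))) +
          length (filter (\<lambda>((a, c), (b, d)). b \<and> d) (pairs (zip u v))) = 4 * common u v"
        by (subst num_columns) simp_all
    qed
    then show ?thesis
      by (simp add: num_def length_filter_blocks C_def split_def sum_list_addf sum_list_const_mult)
  qed
  have "(\<Sum>(s, t)\<leftarrow>pairs (map ones B). s * t) = (\<Sum>(u, v)\<leftarrow>pairs B. ones u * ones v)"
    by (simp add: pairs_map comp_def split_def)
  also have "\<dots> = (\<Sum>(u, v)\<leftarrow>pairs B. common u v +
     length (filter (\<lambda>((a, c), (b, d)). a \<and> d) (pairs (zip u v))) +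
     length (filter (\<lambda>((a, c), (b, d)). c \<and> b) (pairs (zip u v))))"
    by (rule sum_pairs_cong) (simp add: ones_mult_ones len)
  also have "\<dots> = C + num (\<lambda>((a, c), (b, d)). a \<and> d) + num (\<lambda>((a, c), (b, d)). c \<and> b)"
    by (simp add: num_def length_filter_blocks C_def split_def sum_list_addf)
  finally have tri: "tri n = R + (C + num (\<lambda>((a, c), (b, d)). a \<and> d) + num (\<lambda>((a, c), (b, d)). c \<and> b))"
    unfolding n_def R_def by (simp add: tri_sum_list)
  have "5 \<le> R" "5 \<le> C"
    using R C tb lr by linarith+
  have tri8: "tri 8 = 28" "tri 7 = 21"
    by (simp_all add: numeral_eq_Suc)
  have "28 \<le> tri n"
    using tri da \<open>5 \<le> R\<close> \<open>5 \<le> C\<close> by linarith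
  then show "8 \<le> n"
    using tri_mono[of n 7] tri8 by linarith
  show "slim (map ones B)" if "n = 8"
  proof -
    have "R = 5"
      using tri da \<open>5 \<le> R\<close> \<open>5 \<le> C\<close> tri8 that by simp
    then show ?thesis
      using tb that tops_bottoms[OF len(1), of B] by (simp add: slim_def R_def n_def num_def)
  qed
qed


section \<open>Row sums of balanced arrays with eight marks\<close>

lemma slim_le:
  assumes "slim s" "x \<in> set s"
  shows "x < 4"
proof (rule ccontr)
  assume "\<not> x < 4"
  then have "tri 4 \<le> tri x"
    by (intro tri_mono) auto
  moreover have "tri x \<le> sum_list (map tri s)"
    using assms(2) by (intro member_le_sum_list) auto
  ultimately show False
    using assms(1) by (simp add: slim_def numeral_eq_Suc)
qed

definition slim_sums :: "nat list list" where
  "slim_sums =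
    [[0, 2, 3, 1, 2], [0, 2, 3, 2, 1], [0, 3, 1, 2, 2], [0, 3, 2, 1, 2],
     [1, 2, 3, 0, 2], [1, 2, 3, 2, 0], [1, 3, 0, 2, 2], [1, 3, 2, 0, 2],
     [2, 0, 2, 3, 1], [2, 0, 3, 1, 2], [2, 0, 3, 2, 1], [2, 1, 2, 3, 0],
     [2, 1, 3, 0, 2], [2, 1, 3, 2, 0], [2, 2, 0, 3, 1], [2, 2, 1, 3, 0]]"

text \<open>The lists are visited one by one, in reverse, instead of being collected: rewriting over a list
  of a thousand cases would be quadratic.\<close>

fun all_lists :: "'a list \<Rightarrow> ('a list \<Rightarrow> bool) \<Rightarrow> nat \<Rightarrow> 'a list \<Rightarrow> bool" where
  "all_lists xs P 0 acc = P acc"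
| "all_lists xs P (Suc n) acc = list_all (\<lambda>x. all_lists xs P n (x # acc)) xs"

lemma all_listsD:
  assumes "all_lists xs P (length s) acc" and "set s \<subseteq> set xs"
  shows "P (rev s @ acc)"
  using assms by (induction s arbitrary: acc) (auto simp: list_all_iff)

lemma slim_check:
  "all_lists [0, 1, 2, 3] (\<lambda>s. if sum_list s = 8 then slim s \<longrightarrow> s \<in> set slim_sums else True) 5 []"
  by code_simp

lemma slim_in_slim_sums:
  assumes "slim s" "length s = 5"
  shows "s \<in> set slim_sums"
proof -
  have "set (rev s) \<subseteq> set [0, 1, 2, 3]"
    using slim_le[OF assms(1)] by (fastforce simp: numeral_eq_Suc less_Suc_eq)
  then have "if sum_list s = 8 then slim s \<longrightarrow> s \<in> set slim_sums else True"
    using all_listsD[of "[0, 1, 2, 3]" _ "rev s" "[]"] slim_check assms(2) by force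
  with assms(1) show ?thesis
    by (simp add: slim_def)
qed

section \<open>Arrays with given margins\<close>

text \<open>All rows with \<open>s\<close> marks that fit into the column budgets \<open>gs\<close>, each together with the budgets
  that remain.\<close>

fun pick_row :: "nat \<Rightarrow> nat list \<Rightarrow> (bool list \<times> nat list) list" where
  "pick_row 0 gs = [(map (\<lambda>_. False) gs, gs)]"
| "pick_row (Suc s) [] = []"
| "pick_row (Suc s) (0 # gs) = map (\<lambda>(r, h). (False # r, 0 # h)) (pick_row (Suc s) gs)"
| "pick_row (Suc s) (Suc g # gs) =
     map (\<lambda>(r, h). (True # r, g # h)) (pick_row s gs) @
     map (\<lambda>(r, h). (False # r, Suc g # h)) (pick_row (Suc s) gs)"

text \<open>\<open>all_grids P ss g acc\<close> tests \<open>P\<close> on every array that continues the reversed rows \<open>acc\<close> by rows with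
  sums \<open>ss\<close> within the column budgets \<open>g\<close>. The mutual recursion avoids an abstraction over the chosen
  row, under which the simplifier would evaluate \<open>P\<close> symbolically.\<close>

function all_grids :: "(bool list list \<Rightarrow> bool) \<Rightarrow> nat list \<Rightarrow> nat list \<Rightarrow> bool list list \<Rightarrow> bool"
  and all_rows :: "(bool list list \<Rightarrow> bool) \<Rightarrow> nat list \<Rightarrow> bool list list \<Rightarrow> (bool list \<times> nat list) list \<Rightarrow> bool" where
  "all_grids P [] g acc = P (rev acc)"
| "all_grids P (s # ss) g acc = all_rows P ss acc (pick_row s g)"
| "all_rows P ss acc [] = True"
| "all_rows P ss acc ((r, h) # xs) = (all_grids P ss h (r # acc) \<and> all_rows P ss acc xs)"
  by pat_completeness auto
termination
  by (relation "measures
    [case_sum (\<lambda>(P, ss, g, acc). length ss) (\<lambda>(P, ss, acc, xs). length ss),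
     case_sum (\<lambda>(P, ss, g, acc). 0) (\<lambda>(P, ss, acc, xs). Suc (length xs))]") auto

lemma all_rows_iff: "all_rows P ss acc xs \<longleftrightarrow> (\<forall>(r, h) \<in> set xs. all_grids P ss h (r # acc))"
  by (induction xs) auto

fun column_sums :: "nat \<Rightarrow> bool list list \<Rightarrow> nat list" where
  "column_sums n [] = replicate n 0"
| "column_sums n (r # B) = map2 (\<lambda>b k. of_bool b + k) r (column_sums n B)"

lemma length_column_sums [simp]:
  "(\<And>r. r \<in> set B \<Longrightarrow> length r = n) \<Longrightarrow> length (column_sums n B) = n"
  by (induction B) auto

lemma pick_row_complete:
  "length r = length h \<Longrightarrow> (r, h) \<in> set (pick_row (ones r) (map2 (\<lambda>b k. of_bool b + k) r h))"
proof (induction r h rule: list_induct2)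
  case (Cons b r k h)
  let ?g = "map2 (\<lambda>b k. of_bool b + k) r h"
  show ?case
  proof (cases b)
    case True
    then show ?thesis
      using imageI[OF Cons.IH, of "\<lambda>(r, h). (True # r, k # h)"] by simp
  next
    case False
    show ?thesis
    proof (cases "ones r")
      case 0
      then have "\<forall>x\<in>set r. \<not> x"
        by (simp add: ones_def filter_empty_conv)
      then have r: "r = map (\<lambda>_. False) h"
        unfolding map_replicate_const using Cons.hyps by (intro replicate_eqI) auto
      moreover have "map2 (\<lambda>b k. of_bool b + k) (map (\<lambda>_. False) h) h = h"
        by (induction h) auto
      moreover have "ones (map (\<lambda>_. False) h) = 0"
        by (induction h) auto
      ultimately show ?thesis
        using False by simp
    next
      case (Suc s)
      then show ?thesis
        using False imageI[OF Cons.IH, of "\<lambda>(r, h). (False # r, k # h)"] by (cases k) simp_all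
    qed
  qed
qed simp

lemma all_gridsD:
  assumes "\<And>r. r \<in> set B \<Longrightarrow> length r = n"
    and "all_grids P (map ones B) (column_sums n B) acc"
  shows "P (rev acc @ B)"
  using assms
proof (induction B arbitrary: acc)
  case (Cons r B)
  have "(r, column_sums n B) \<in> set (pick_row (ones r) (column_sums n (r # B)))"
    using pick_row_complete[of r "column_sums n B"] Cons.prems(1) by simp
  then have "all_grids P (map ones B) (column_sums n B) (r # acc)"
    using Cons.prems(2) by (auto simp: all_rows_iff simp del: column_sums.simps)
  then show ?case
    using Cons.IH[of "r # acc"] Cons.prems(1) by simp
qed simp

lemma column_sums_grid:
  "column_sums n (map (\<lambda>i. map (G i) [0..<n]) is) = map (\<lambda>j. ones (map (\<lambda>i. G i j) is)) [0..<n]"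
  by (induction "is") (auto simp: list_eq_iff_nth_eq)

lemma column_sums_grid_swap: "column_sums n (grid n G) = map ones (grid n (\<lambda>i j. G j i))"
  unfolding grid_def by (simp add: column_sums_grid comp_def)

lemma sum_column_sums:
  "(\<And>r. r \<in> set B \<Longrightarrow> length r = n) \<Longrightarrow> sum_list (column_sums n B) = sum_list (map ones B)"
proof (induction B)
  case (Cons r B)
  have "length r = length h \<Longrightarrow> sum_list (map2 (\<lambda>b k. of_bool b + k) r h) = ones r + sum_list h" for h
    by (induction r h rule: list_induct2) auto
  with Cons show ?case by simp
qed simp

section \<open>Counting block patterns by rewriting\<close>

fun tally :: "bool list \<Rightarrow> nat \<Rightarrow> nat" where
  "tally [] k = k"
| "tally (True # v) k = tally v (Suc k)"
| "tally (False # v) k = tally v k"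

text \<open>The number of pairs of positions, in increasing order, with a mark of \<open>u\<close> at the first and a mark
  of \<open>v\<close> at the second one. Matching on the marks and accumulating in \<open>k\<close> keeps conditionals out of the
  inner loop.\<close>

fun rising :: "bool list \<Rightarrow> bool list \<Rightarrow> nat \<Rightarrow> nat" where
  "rising (True # u) (y # v) k = rising u v (tally v k)"
| "rising (False # u) (y # v) k = rising u v k"
| "rising _ _ k = k"

definition count_from :: "bool \<times> bool \<Rightarrow> bool \<times> bool \<Rightarrow> (bool \<times> bool) list \<Rightarrow> nat \<Rightarrow> nat" where
  "count_from p q zs = rising (map (\<lambda>z. z = p) zs) (map (\<lambda>z. z = q) zs)"

fun count_blocks :: "bool \<times> bool \<Rightarrow> bool \<times> bool \<Rightarrow> bool list list \<Rightarrow> nat" where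
  "count_blocks p q [] = 0"
| "count_blocks p q (u # B) = fold (\<lambda>v. count_from p q (zip u v)) B (count_blocks p q B)"

lemma tally: "tally v k = length (filter (\<lambda>b. b) v) + k"
  by (induction v k rule: tally.induct) auto

lemma count_from_pairs: "count_from p q zs k = length (filter (\<lambda>s. s = (p, q)) (pairs zs)) + k"
proof (induction zs arbitrary: k)
  case (Cons z zs)
  then show ?case
    by (cases "z = p") (auto simp: count_from_def tally filter_map comp_def)
qed (simp add: count_from_def)

lemma count_blocks_filter: "count_blocks p q B = length (filter (\<lambda>s. s = (p, q)) (blocks B))"
  unfolding length_filter_blocks
proof (induction B)
  case (Cons u B)
  have "fold (\<lambda>v. count_from p q (zip u v)) vs m =
      (\<Sum>v\<leftarrow>vs. length (filter (\<lambda>s. s = (p, q)) (pairs (zip u v)))) + m" for vs m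
    by (induction vs arbitrary: m) (auto simp: count_from_pairs)
  then show ?case using Cons by (simp add: comp_def)
qed simp

definition choices :: "bool \<Rightarrow> nat" where
  "choices b = (if b then 1 else 2)"

lemma wt_singleton: "wt {b} = choices b"
  by (simp add: wt_def choices_def)

text \<open>The conditional stops at the first failing pattern; a conjunction would be evaluated in full.\<close>

fun passes :: "((bool \<times> bool) \<times> (bool \<times> bool)) list \<Rightarrow> bool list list \<Rightarrow> bool" where
  "passes [] B = True"
| "passes (((a, c), (b, d)) # ps) B =
    (if choices a * choices c * (choices b * choices d) \<le> count_blocks (a, c) (b, d) B then passes ps B else False)"

lemma balanced_passes:
  assumes "balanced B"
  shows "passes ps B"
proof (induction ps)
  case (Cons p ps)
  obtain a c b d where p: "p = ((a, c), (b, d))"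
    by (metis surj_pair)
  have "(\<lambda>((a', c'), (b', d')). a' \<in> {a} \<and> c' \<in> {c} \<and> b' \<in> {b} \<and> d' \<in> {d}) = (\<lambda>s. s = ((a, c), b, d))"
    by (simp add: fun_eq_iff split_paired_all)
  then have "wt {a} * wt {c} * (wt {b} * wt {d}) \<le> count_blocks (a, c) (b, d) B"
    using balancedD[OF assms, of "{a}" "{c}" "{b}" "{d}"] by (simp only: count_blocks_filter)
  then show ?case
    using Cons.IH by (simp only: p passes.simps if_True wt_singleton)
qed simp

section \<open>Balanced arrays with eight marks\<close>

text \<open>The patterns whose counts single out the 16 arrays below. The two bare diagonals come first
  because they reject most of the candidates.\<close>

definition slim_tests :: "((bool \<times> bool) \<times> (bool \<times> bool)) list" where
  "slim_tests =
     [((True, False), (False, True)), ((False, True), (True, False)),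
      ((True, True), (True, False)), ((True, True), (False, True)),
      ((True, False), (True, True)), ((False, True), (True, True)), ((True, True), (True, True)),
      ((True, False), (False, False)), ((False, True), (False, False)),
      ((False, False), (True, False)), ((False, False), (False, True))]"

definition slim_grids :: "bool list list list" where
  "slim_grids =
    (let T = True; F = False in
     [[[T,F,F,T,F], [F,F,F,F,F], [T,F,F,T,T], [F,T,F,T,F], [F,T,F,F,F]],
      [[F,T,F,F,T], [F,F,F,F,F], [T,T,F,F,T], [F,T,T,F,F], [F,F,T,F,F]],
      [[T,F,F,T,F], [F,F,F,F,F], [T,F,F,T,T], [F,F,T,T,F], [F,F,T,F,F]],
      [[T,F,T,F,F], [F,F,F,T,T], [F,F,F,F,F], [T,F,T,T,F], [F,F,T,F,F]],
      [[T,F,T,F,F], [F,F,F,F,F], [F,F,F,T,T], [T,F,T,T,F], [F,F,T,F,F]],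
      [[F,F,T,F,T], [T,T,F,F,F], [F,F,F,F,F], [F,T,T,F,T], [F,F,T,F,F]],
      [[F,F,T,F,T], [F,F,F,F,F], [T,T,F,F,F], [F,T,T,F,T], [F,F,T,F,F]],
      [[F,F,T,F,F], [T,F,T,T,F], [F,F,F,T,T], [F,F,F,F,F], [T,F,T,F,F]],
      [[F,F,T,F,F], [T,F,T,T,F], [F,F,F,F,F], [F,F,F,T,T], [T,F,T,F,F]],
      [[F,T,F,F,T], [F,F,F,F,F], [T,T,F,F,T], [F,T,F,T,F], [F,F,F,T,F]],
      [[F,T,F,F,F], [F,T,F,T,F], [T,F,F,T,T], [F,F,F,F,F], [T,F,F,T,F]],
      [[F,F,T,F,F], [F,F,T,T,F], [T,F,F,T,T], [F,F,F,F,F], [T,F,F,T,F]],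
      [[F,F,T,F,F], [F,T,T,F,F], [T,T,F,F,T], [F,F,F,F,F], [F,T,F,F,T]],
      [[F,F,F,T,F], [F,T,F,T,F], [T,T,F,F,T], [F,F,F,F,F], [F,T,F,F,T]],
      [[F,F,T,F,F], [F,T,T,F,T], [T,T,F,F,F], [F,F,F,F,F], [F,F,T,F,T]],
      [[F,F,T,F,F], [F,T,T,F,T], [F,F,F,F,F], [T,T,F,F,F], [F,F,T,F,T]]])"

definition slim_ok :: "bool list list \<Rightarrow> bool" where
  "slim_ok B = (if passes slim_tests B then B \<in> set slim_grids else True)"

lemma slim_grids_check:
  "list_all (\<lambda>s. list_all (\<lambda>t. all_grids slim_ok s t []) slim_sums) slim_sums"
  by code_simp

lemma slim_grid:
  assumes "balanced (grid 5 G)" and "balanced (grid 5 (\<lambda>i j. G j i))"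
    and "sum_list (map ones (grid 5 G)) = 8"
  shows "grid 5 G \<in> set slim_grids"
proof -
  let ?s = "map ones (grid 5 G)" and ?t = "map ones (grid 5 (\<lambda>i j. G j i))"
  have t: "?t = column_sums 5 (grid 5 G)"
    by (simp add: column_sums_grid_swap)
  have "sum_list ?t = 8"
    unfolding t using assms(3) by (subst sum_column_sums) auto
  then have "?s \<in> set slim_sums" "?t \<in> set slim_sums"
    using assms by (auto intro!: slim_in_slim_sums balanced_ones(2))
  then have "all_grids slim_ok ?s ?t []"
    using slim_grids_check unfolding list_all_iff by blast
  then have "slim_ok (grid 5 G)"
    unfolding t using all_gridsD[of "grid 5 G" 5 slim_ok "[]"] by simp
  then show ?thesis
    using balanced_passes[OF assms(1), of slim_tests] by (simp add: slim_ok_def)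
qed

definition meet :: "bool list list \<Rightarrow> bool list list \<Rightarrow> bool" where
  "meet B C \<longleftrightarrow> list_ex (\<lambda>(u, v). list_ex (\<lambda>(a, c). a \<and> c) (zip u v)) (zip B C)"

lemma meet_grid: "meet (grid n G) (grid n H) \<Longrightarrow> \<exists>i j. G i j \<and> H i j"
  unfolding meet_def grid_def list_ex_iff set_zip by auto blast

lemma slim_grids_meet: "list_all (\<lambda>B. list_all (meet B) slim_grids) slim_grids"
  by code_simp

section \<open>No array with five rows and columns\<close>

lemma no_grid_5: "\<not> ({1, 2, 3} \<times> {1, 2, 3}) \<times> ({1, 2, 3} \<times> {1, 2, 3}) \<subseteq> set (blocks (grid 5 F))"
  for F :: "nat \<Rightarrow> nat \<Rightarrow> nat"
proof
  assume all: "({1, 2, 3} \<times> {1, 2, 3}) \<times> ({1, 2, 3} \<times> {1, 2, 3}) \<subseteq> set (blocks (grid 5 F))"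
  have all': "({1, 2, 3} \<times> {1, 2, 3}) \<times> ({1, 2, 3} \<times> {1, 2, 3}) \<subseteq> set (blocks (grid 5 (\<lambda>i j. F j i)))"
  proof
    fix z :: "(nat \<times> nat) \<times> (nat \<times> nat)"
    assume "z \<in> ({1, 2, 3} \<times> {1, 2, 3}) \<times> ({1, 2, 3} \<times> {1, 2, 3})"
    moreover obtain a c b d where z: "z = ((a, c), (b, d))"
      by (metis surj_pair)
    ultimately have "((a, b), (c, d)) \<in> set (blocks (grid 5 F))"
      using all by auto
    then show "z \<in> set (blocks (grid 5 (\<lambda>i j. F j i)))"
      unfolding z set_blocks_grid by blast
  qed
  define G where "G x = (\<lambda>i j. F i j = x)" for x
  define n where "n x = sum_list (map ones (grid 5 (G x)))" for x
  have bal: "balanced (grid 5 (G x))" "balanced (grid 5 (\<lambda>i j. G x j i))" if "x \<in> {1, 2, 3}" for x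
    using balanced_letter[OF all that] balanced_letter[OF all' that] by (simp_all add: map_grid G_def)
  have ge: "8 \<le> n x" if "x \<in> {1, 2, 3}" for x
    unfolding n_def using bal(1)[OF that] by (intro balanced_ones) auto
  have row: "ones (map (\<lambda>y. y = 1) r) + ones (map (\<lambda>y. y = 2) r) + ones (map (\<lambda>y. y = 3) r) \<le> length r"
    for r :: "nat list"
    by (induction r) auto
  have le: "n 1 + n 2 + n 3 \<le> 25"
  proof -
    have n: "n x = (\<Sum>r\<leftarrow>grid 5 F. ones (map (\<lambda>y. y = x) r))" for x
      unfolding n_def G_def by (simp add: grid_def comp_def)
    have "n 1 + n 2 + n 3 \<le> (\<Sum>r\<leftarrow>grid 5 F. length r)"
      unfolding n sum_list_addf[symmetric] by (rule sum_list_mono) (rule row)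
    also have "\<dots> = 25"
      by (simp add: grid_def comp_def sum_list_triv)
    finally show ?thesis .
  qed
  obtain x y where xy: "x \<in> {1, 2, 3}" "y \<in> {1, 2, 3}" "x \<noteq> y" "n x = 8" "n y = 8"
  proof -
    have "n 1 = 8 \<and> n 2 = 8 \<or> n 1 = 8 \<and> n 3 = 8 \<or> n 2 = 8 \<and> n 3 = 8"
      using ge[of 1] ge[of 2] ge[of 3] le by simp linarith
    then show ?thesis
      using that[of 1 2] that[of 1 3] that[of 2 3] by auto
  qed
  have "grid 5 (G x) \<in> set slim_grids" "grid 5 (G y) \<in> set slim_grids"
    using xy bal by (auto intro!: slim_grid simp: n_def)
  then have "meet (grid 5 (G x)) (grid 5 (G y))"
    using slim_grids_meet by (simp add: list_all_iff)
  then show False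
    using meet_grid \<open>x \<noteq> y\<close> by (metis G_def)
qed

section \<open>Blocks as submatrices\<close>

lemma pick_pair:
  assumes "i < (k::nat)"
  shows "pick {i, k} 0 = i" "pick {i, k} (Suc 0) = k"
proof -
  show 0: "pick {i, k} 0 = i"
    using assms by (auto intro!: Least_equality)
  show "pick {i, k} (Suc 0) = k"
    unfolding pick.simps(2) 0 using assms by (auto intro!: Least_equality)
qed

lemma two_subset:
  assumes "card (I :: nat set) = 2"
  obtains i k where "i < k" "I = {i, k}"
proof -
  obtain i k where "I = {i, k}" "i \<noteq> k"
    using assms by (auto simp: card_2_iff)
  then show ?thesis
    using that[of i k] that[of k i] by (cases "i < k") (auto simp: insert_commute)
qed

definition mat_of_block :: "('a \<times> 'a) \<times> ('a \<times> 'a) \<Rightarrow> 'a mat" where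
  "mat_of_block = (\<lambda>((a, c), (b, d)). mat 2 2 (\<lambda>(i, j). if j = 0 then if i = 0 then a else c else if i = 0 then b else d))"

lemma inj_mat_of_block: "mat_of_block p = mat_of_block q \<longleftrightarrow> p = q"
proof
  assume eq: "mat_of_block p = mat_of_block q"
  have "mat_of_block p $$ (i, j) = mat_of_block q $$ (i, j)" for i j
    by (simp add: eq)
  from this[of 0 0] this[of 0 1] this[of 1 0] this[of 1 1] show "p = q"
    by (auto simp: mat_of_block_def split: prod.splits)
qed simp

lemma submatrix_pair:
  assumes "A \<in> carrier_mat n n" "i < k" "k < n" "j < l" "l < n"
  shows "submatrix A {i, k} {j, l} = mat_of_block ((A $$ (i, j), A $$ (k, j)), (A $$ (i, l), A $$ (k, l)))"
proof -
  have "{r. r < n \<and> r \<in> {i, k}} = {i, k}" "{r. r < n \<and> r \<in> {j, l}} = {j, l}"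
    using assms by auto
  then have card: "card {r. r < dim_row A \<and> r \<in> {i, k}} = 2" "card {r. r < dim_col A \<and> r \<in> {j, l}} = 2"
    using assms by auto
  show ?thesis
    unfolding submatrix_def card mat_of_block_def
    using assms by (auto simp: less_2_cases_iff pick_pair simp del: pick.simps intro!: eq_matI)
qed

lemma contains_submatrix_block:
  assumes "A \<in> carrier_mat n n"
  shows "contains_submatrix A (mat_of_block p) \<longleftrightarrow> p \<in> set (blocks (grid n (\<lambda>i j. A $$ (i, j))))"
proof
  assume "contains_submatrix A (mat_of_block p)"
  then obtain I J where IJ: "I \<subseteq> {..<n}" "J \<subseteq> {..<n}" "submatrix A I J = mat_of_block p"
    using assms by (auto simp: contains_submatrix_def)
  have "dim_row (mat_of_block p) = 2" "dim_col (mat_of_block p) = 2"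
    by (auto simp: mat_of_block_def split: prod.splits)
  moreover have "{i. i < n \<and> i \<in> I} = I" "{j. j < n \<and> j \<in> J} = J"
    using IJ by auto
  ultimately have "card I = 2" "card J = 2"
    using dim_submatrix[of A I J] assms by (auto simp: IJ(3))
  then obtain i k j l where ik: "i < k" "I = {i, k}" "j < l" "J = {j, l}"
    by (metis two_subset)
  then have "mat_of_block p = mat_of_block ((A $$ (i, j), A $$ (k, j)), (A $$ (i, l), A $$ (k, l)))"
    using IJ submatrix_pair[OF assms] by auto
  then show "p \<in> set (blocks (grid n (\<lambda>i j. A $$ (i, j))))"
    unfolding inj_mat_of_block set_blocks_grid using ik IJ by auto
next
  assume "p \<in> set (blocks (grid n (\<lambda>i j. A $$ (i, j))))"
  then obtain i k j l where ik: "i < k" "k < n" "j < l" "l < n"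
    and p: "p = ((A $$ (i, j), A $$ (k, j)), (A $$ (i, l), A $$ (k, l)))"
    unfolding set_blocks_grid by blast
  show "contains_submatrix A (mat_of_block p)"
    unfolding contains_submatrix_def p submatrix_pair[OF assms ik, symmetric]
    using ik assms by (intro exI[of _ "{i, k}"] exI[of _ "{j, l}"]) auto
qed

lemma mats_over_2:
  "mats_over 2 a = mat_of_block ` (({1..a} \<times> {1..a}) \<times> ({1..a} \<times> {1..a}))"
proof (intro equalityI subsetI)
  fix B
  assume B: "B \<in> mats_over 2 a"
  then have dim: "B \<in> carrier_mat 2 2"
    by (simp add: mats_over_def)
  have entry: "B $$ (i, j) \<in> {1..a}" if "i < 2" "j < 2" for i j
    using B that unfolding mats_over_def elements_mat_def by force
  have "B = mat_of_block ((B $$ (0, 0), B $$ (1, 0)), (B $$ (0, 1), B $$ (1, 1)))"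
    using dim unfolding mat_of_block_def by (auto simp: less_2_cases_iff intro!: eq_matI)
  then show "B \<in> mat_of_block ` (({1..a} \<times> {1..a}) \<times> ({1..a} \<times> {1..a}))"
    by (rule image_eqI) (use entry in simp)
next
  fix B
  assume "B \<in> mat_of_block ` (({1..a} \<times> {1..a}) \<times> ({1..a} \<times> {1..a}))"
  then show "B \<in> mats_over 2 a"
    by (auto simp: mats_over_def mat_of_block_def elements_mat_def)
qed

lemma omnimosaic_2:
  "omnimosaic n 2 a A \<longleftrightarrow> A \<in> mats_over n a \<and>
     ({1..a} \<times> {1..a}) \<times> ({1..a} \<times> {1..a}) \<subseteq> set (blocks (grid n (\<lambda>i j. A $$ (i, j))))"
proof (cases "A \<in> mats_over n a")
  case True
  then have "A \<in> carrier_mat n n"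
    by (simp add: mats_over_def)
  with True show ?thesis
    unfolding omnimosaic_def mats_over_2 ball_simps by (auto simp only: contains_submatrix_block)
qed (simp add: omnimosaic_def)

lemma atLeastAtMost_3: "{1..3} = {1, 2, 3::nat}"
  by auto

section \<open>The smallest order\<close>

text \<open>Found by simulated annealing on the number of distinct blocks.\<close>

definition witness :: "nat list list" where
  "witness =
    [[1, 2, 2, 3, 1, 3],
     [3, 1, 1, 3, 1, 2],
     [3, 1, 3, 3, 2, 2],
     [2, 2, 2, 1, 1, 3],
     [2, 1, 3, 1, 2, 2],
     [3, 1, 2, 1, 3, 1]]"

lemma witness_check:
  "list_all (\<lambda>p. p \<in> set (blocks witness))
     (List.product (List.product [1, 2, 3] [1, 2, 3]) (List.product [1, 2, 3] [1, 2, 3]))"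
  by code_simp

lemma witness_omnimosaic: "omnimosaic 6 2 3 (mat 6 6 (\<lambda>(i, j). witness ! i ! j))"
proof -
  let ?A = "mat 6 6 (\<lambda>(i, j). witness ! i ! j)"
  have grid: "grid 6 (\<lambda>i j. ?A $$ (i, j)) = witness"
    by (simp add: grid_def witness_def upt_rec numeral_eq_Suc)
  have "witness ! i ! j \<in> {1..3}" if "i < 6" "j < 6" for i j
  proof -
    have "\<forall>r\<in>set witness. length r = 6 \<and> set r \<subseteq> {1..3}" "length witness = 6"
      by (simp_all add: witness_def)
    then show ?thesis
      using that by (metis nth_mem subsetD)
  qed
  then have "?A \<in> mats_over 6 3"
    by (auto simp: mats_over_def elements_mat_def)
  moreover have "({1..3} \<times> {1..3}) \<times> ({1..3} \<times> {1..3}) \<subseteq> set (blocks witness)"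
    using witness_check unfolding list_all_iff by (simp only: atLeastAtMost_3 set_product list.set) blast
  ultimately show ?thesis
    unfolding omnimosaic_2 grid by blast
qed

theorem mainTheorem3:
  shows "omega 2 3 = 6"
  unfolding omega_def
proof (rule Least_equality)
  show "\<exists>A. omnimosaic 6 2 3 A"
    using witness_omnimosaic by blast
next
  fix n
  assume "\<exists>A. omnimosaic n 2 3 A"
  then obtain A :: "nat mat" where A: "({1..3} \<times> {1..3}) \<times> ({1..3} \<times> {1..3}) \<subseteq> set (blocks (grid n (\<lambda>i j. A $$ (i, j))))"
    by (auto simp only: omnimosaic_2)
  show "6 \<le> n"
  proof (rule ccontr)
    assume "\<not> 6 \<le> n"
    \<comment> \<open>For smaller \<open>n\<close> the array reads \<open>A\<close> beyond its borders, where the entries are unspecified; the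
      additional cells can only add blocks.\<close>
    have "({1..3} \<times> {1..3}) \<times> ({1..3} \<times> {1..3}) \<subseteq> set (blocks (grid 5 (\<lambda>i j. A $$ (i, j))))"
      using \<open>\<not> 6 \<le> n\<close> by (intro subset_trans[OF A blocks_grid_mono]) simp
    then have "({1, 2, 3} \<times> {1, 2, 3}) \<times> ({1, 2, 3} \<times> {1, 2, 3}) \<subseteq> set (blocks (grid 5 (\<lambda>i j. A $$ (i, j))))"
      by (simp only: atLeastAtMost_3)
    with no_grid_5 show False
      by (rule notE)
  qed
qed

end
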